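(* Let $\phi(x) = x^d + c$, where $c,d \in \mathbb{Z}$ and $d \geq 2$. Let $G$ be the index divisibility graph corresponding to $\phi$, and let $G_V$ be the vertex set of $G$. Then $G_V = D_{d,c}$, where $D_{d,c} = \{n \in \mathbb{Z} : n \ge 1,\ n \mid \phi^n(0)\}$.
   Context: Here $\phi^n$ denotes the $n$-th iterate of $\phi$. Define $D_{d,c} = \{n \in \mathbb{Z} : n \geq 1,\ n \mid \phi^n(0)\}$ and $P_{d,c} = \{p \in D_{d,c} : p \text{ is prime}\}$. Let $v_p$ denote the $p$-adic valuation on integers, with the convention $v_p(0) = \infty$. The index divisibility graph $G$ of $\phi$ is the directed graph constructed iteratively as follows. Initially $1$ is in the vertex set $G_V$. For each $n \in G_V$, adjoin the vertex $np$ and the directed edge $(n, np)$ if at least one of the following holds: (type 1) $p$ is a prime satisfying $v_p(\phi^n(0)) > v_p(n)$; (type 2) $p \in P_{d,c}$ and $v_p(n) = 0$. Thus $G_V$ is the smallest set of positive integers containing $1$ and closed under these rules. *)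

theory Defs
  imports
    "HOL-Computational_Algebra.Primes"
    "HOL-Library.Extended_Nat"
    "Graph_Theory.Pair_Digraph"
begin

definition phi :: "nat \<Rightarrow> int \<Rightarrow> int \<Rightarrow> int" where
  "phi d c x = x ^ d + c"

definition index_div_set :: "nat \<Rightarrow> int \<Rightarrow> nat set" where
  "index_div_set d c = {n. n \<ge> 1 \<and> int n dvd (phi d c ^^ n) 0}"

definition index_div_primes :: "nat \<Rightarrow> int \<Rightarrow> nat set" where
  "index_div_primes d c = {p \<in> index_div_set d c. prime p}"

text \<open>
  The library function \<^const>\<open>multiplicity\<close> returns 0 at the argument 0, whereas here
  the valuation of 0 has to be infinite.
\<close>

definition val :: "nat \<Rightarrow> int \<Rightarrow> enat" where
  "val p x = (if x = 0 then \<infinity> else enat (multiplicity (int p) x))"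

definition admissible :: "nat \<Rightarrow> int \<Rightarrow> nat \<Rightarrow> nat \<Rightarrow> bool" where
  "admissible d c n p \<longleftrightarrow>
     (prime p \<and> val p ((phi d c ^^ n) 0) > val p (int n)) \<or>
     (p \<in> index_div_primes d c \<and> val p (int n) = 0)"

inductive_set index_div_verts :: "nat \<Rightarrow> int \<Rightarrow> nat set" for d :: nat and c :: int where
  one: "1 \<in> index_div_verts d c"
| step: "n \<in> index_div_verts d c \<Longrightarrow> admissible d c n p \<Longrightarrow> n * p \<in> index_div_verts d c"

definition index_div_graph :: "nat \<Rightarrow> int \<Rightarrow> nat pair_pre_digraph" where
  "index_div_graph d c =
     \<lparr> pverts = index_div_verts d c,
       parcs = {(n, n * p) | n p. n \<in> index_div_verts d c \<and> admissible d c n p} \<rparr>"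

end

theory Submission
  imports Defs
begin

text \<open>
  Write \<open>a\<^sub>n = \<phi>\<^sup>n(0)\<close>. As \<open>\<phi>\<^sup>r(x) \<equiv> a\<^sub>r\<close> modulo \<open>x\<^sup>2\<close> for \<open>r \<ge> 1\<close>, the sequence is a rigid
  divisibility sequence: the \<open>q\<close>-adic valuation of \<open>a\<^sub>k\<close> is either \<open>0\<close> or a constant depending only
  on \<open>q\<close>, and it is positive exactly when \<open>k\<close> is a multiple of the period \<open>r\<^sub>q \<le> q\<close> of \<open>0\<close> modulo
  \<open>q\<close>. Given \<open>n > 1\<close> dividing \<open>a\<^sub>n\<close>, let \<open>p\<close> be the largest prime factor of \<open>n\<close> and \<open>m = n / p\<close>.
  For primes \<open>q < p\<close> dividing \<open>n\<close> the period \<open>r\<^sub>q\<close> is prime to \<open>p\<close>, so it divides \<open>m\<close>, and the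
  \<open>q\<close>-part of \<open>n\<close> divides \<open>a\<^sub>m\<close>. The same holds for \<open>q = p\<close>, which gives an edge of type 1, unless
  \<open>r\<^sub>p = p\<close> and \<open>p\<close> does not divide \<open>m\<close>, which gives an edge of type 2.
\<close>

section \<open>Congruences and divisibility between iterates\<close>

lemma dvd_phi_iterate_diff: "x - y dvd (phi d c ^^ k) x - (phi d c ^^ k) y"
proof (induction k)
  case (Suc k)
  let ?X = "(phi d c ^^ k) x" and ?Y = "(phi d c ^^ k) y"
  have "?X - ?Y dvd ?X ^ d - ?Y ^ d"
    by (simp add: power_diff_sumr2)
  with Suc have "x - y dvd ?X ^ d - ?Y ^ d"
    by (rule dvd_trans)
  then show ?case
    by (simp add: phi_def[of d c ?X] phi_def[of d c ?Y])
qed simp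

text \<open>After one step the difference is x^d, a multiple of x^2 since d \<ge> 2; the other k - 1
  steps preserve congruences.\<close>

lemma square_dvd_phi_iterate_diff:
  assumes "d \<ge> 2" "k \<ge> 1"
  shows "x\<^sup>2 dvd (phi d c ^^ k) x - (phi d c ^^ k) 0"
proof -
  obtain j where k: "k = Suc j"
    using assms(2) by (cases k) auto
  have "x\<^sup>2 dvd phi d c x - phi d c 0"
    using assms(1) by (simp add: phi_def le_imp_power_dvd zero_power)
  also have "\<dots> dvd (phi d c ^^ j) (phi d c x) - (phi d c ^^ j) (phi d c 0)"
    by (rule dvd_phi_iterate_diff)
  finally show ?thesis
    by (simp add: k funpow_Suc_right del: funpow.simps)
qed

lemma phi_iterate_add:
  "(phi d c ^^ (m + k)) 0 = (phi d c ^^ k) ((phi d c ^^ m) 0)"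
  by (metis add.commute comp_apply funpow_add)

lemma phi_iterate_dvd_diff:
  "(phi d c ^^ m) 0 dvd (phi d c ^^ (m + k)) 0 - (phi d c ^^ k) 0"
  using dvd_phi_iterate_diff[of "(phi d c ^^ m) 0" 0] by (simp add: phi_iterate_add)

lemma phi_iterate_dvd_mult: "(phi d c ^^ m) 0 dvd (phi d c ^^ (m * j)) 0"
proof (induction j)
  case (Suc j)
  then show ?case
    using phi_iterate_dvd_diff[where m = m and k = "m * j"] by (metis dvd_diff_left_iff mult_Suc_right)
qed simp

lemma phi_iterate_dvd:
  assumes "m dvd n"
  shows "(phi d c ^^ m) 0 dvd (phi d c ^^ n) 0"
  using assms phi_iterate_dvd_mult by (metis dvdE)

text \<open>With n = r * i + r, the last r steps start from the iterate at r * i, which is a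
  multiple of the iterate at r.\<close>

lemma square_phi_iterate_dvd_diff:
  assumes "d \<ge> 2" "r dvd n" "n \<ge> 1"
  shows "((phi d c ^^ r) 0)\<^sup>2 dvd (phi d c ^^ n) 0 - (phi d c ^^ r) 0"
proof -
  have r: "r \<ge> 1"
    using assms by (cases r) auto
  obtain j where "n = r * j"
    using assms(2) by (rule dvdE)
  with assms(3) obtain i where n: "n = r * i + r"
    by (cases j) auto
  have "((phi d c ^^ r) 0)\<^sup>2 dvd ((phi d c ^^ (r * i)) 0)\<^sup>2"
    by (intro dvd_power_same phi_iterate_dvd) simp
  also have "\<dots> dvd (phi d c ^^ n) 0 - (phi d c ^^ r) 0"
    unfolding n phi_iterate_add using assms(1) r by (rule square_dvd_phi_iterate_diff)
  finally show ?thesis .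
qed

section \<open>Rigidity and the period of 0 modulo a prime\<close>

lemma phi_iterate_rigid:
  fixes q e r n :: nat
  assumes "d \<ge> 2" "prime q" "int q dvd (phi d c ^^ r) 0" "r dvd n" "n \<ge> 1"
    and "int (q ^ e) dvd (phi d c ^^ n) 0"
  shows "int (q ^ e) dvd (phi d c ^^ r) 0"
proof -
  let ?a = "(phi d c ^^ r) 0"
  obtain t where "(phi d c ^^ n) 0 - ?a = ?a\<^sup>2 * t"
    using square_phi_iterate_dvd_diff[OF assms(1,4,5)] by (rule dvdE)
  then have eq: "(phi d c ^^ n) 0 = ?a * (1 + ?a * t)"
    by (simp add: algebra_simps power2_eq_square)
  \<comment> \<open>As q divides \<open>?a\<close>, the cofactor is 1 modulo q, so every power of q
    in the n-th iterate comes from \<open>?a\<close>.\<close>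
  have "\<not> int q dvd 1 + ?a * t"
    using assms(2,3) by (metis dvd_add_left_iff dvd_mult2 not_prime_unit prime_nat_int_transfer)
  then have "coprime (int (q ^ e)) (1 + ?a * t)"
    using assms(2) by (simp add: prime_imp_coprime)
  with assms(6) show ?thesis
    unfolding eq by (simp add: coprime_dvd_mult_left_iff)
qed

lemma phi_iterate_period:
  fixes q n :: nat
  assumes "q \<ge> 1" "n \<ge> 1" "int q dvd (phi d c ^^ n) 0"
  obtains r where "1 \<le> r" "r \<le> q" "r dvd n" "int q dvd (phi d c ^^ r) 0"
proof -
  let ?a = "\<lambda>k. (phi d c ^^ k) 0"
  have ex: "\<exists>s. 1 \<le> s \<and> s \<le> q \<and> int q dvd ?a s"
  proof -
    \<comment> \<open>Pigeonhole: q + 1 indices, but only q residues.\<close>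
    have "\<not> inj_on (\<lambda>k. ?a k mod int q) {..q}"
    proof
      assume "inj_on (\<lambda>k. ?a k mod int q) {..q}"
      moreover have "(\<lambda>k. ?a k mod int q) ` {..q} \<subseteq> {0..<int q}"
        using assms(1) by auto
      ultimately have "card {..q} \<le> card {0..<int q}"
        by (intro card_inj_on_le) auto
      then show False by simp
    qed
    then obtain i j where ij: "i < j" "j \<le> q" "?a i mod int q = ?a j mod int q"
      unfolding inj_on_def by (metis atMost_iff linorder_neqE_nat)
    \<comment> \<open>This shift moves i to a multiple of n, where the orbit is back at 0 modulo q;
      so the repetition at i and j yields a return to 0 after j - i steps.\<close>
    let ?t = "n * i - i"
    have ni: "i + ?t = n * i"
      using assms(2) by simp
    have "int q dvd ?a j - ?a i"
      using ij(3) by (metis mod_eq_dvd_iff)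
    also have "\<dots> dvd ?a (j + ?t) - ?a (i + ?t)"
      unfolding phi_iterate_add by (rule dvd_phi_iterate_diff)
    finally have "int q dvd ?a (n * i + (j - i)) - ?a (n * i)"
      using ni ij(1) by (metis add.assoc add.commute le_add_diff_inverse less_imp_le)
    moreover have qni: "int q dvd ?a (n * i)"
      using assms(3) phi_iterate_dvd_mult by (rule dvd_trans)
    ultimately have "int q dvd ?a (n * i + (j - i))"
      by (simp add: dvd_diff_left_iff)
    moreover have "int q dvd ?a (n * i + (j - i)) - ?a (j - i)"
      using qni phi_iterate_dvd_diff by (rule dvd_trans)
    ultimately have "int q dvd ?a (j - i)"
      by (simp add: dvd_diff_right_iff)
    then show ?thesis
      using ij by (intro exI[of _ "j - i"]) auto
  qed
  define r where "r = (LEAST s. 1 \<le> s \<and> s \<le> q \<and> int q dvd ?a s)"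
  have r: "1 \<le> r" "r \<le> q" "int q dvd ?a r"
    using LeastI_ex[OF ex] unfolding r_def by auto
  \<comment> \<open>The orbit is at 0 modulo q at the multiple r * (n div r), so the remainder n mod
    r is a return time below the least positive one.\<close>
  have qm: "int q dvd ?a (r * (n div r))"
    using r(3) phi_iterate_dvd_mult by (rule dvd_trans)
  have "int q dvd ?a (r * (n div r) + n mod r) - ?a (n mod r)"
    using qm phi_iterate_dvd_diff by (rule dvd_trans)
  then have "int q dvd ?a (n mod r)"
    using assms(3) by (simp add: dvd_diff_right_iff)
  moreover have "n mod r < r"
    using r(1) by simp
  ultimately have "n mod r = 0"
    using r(2) not_less_Least[of "n mod r" "\<lambda>s. 1 \<le> s \<and> s \<le> q \<and> int q dvd ?a s"]
    unfolding r_def[symmetric] by (cases "n mod r") auto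
  with r that show thesis
    by blast
qed

section \<open>Prime powers and valuations\<close>

lemma int_dvd_if_prime_powers_dvd:
  fixes m :: nat and x :: int
  assumes "m \<ge> 1" and "\<And>q k. prime q \<Longrightarrow> q ^ k dvd m \<Longrightarrow> int (q ^ k) dvd x"
  shows "int m dvd x"
proof (cases "x = 0")
  case False
  have "m dvd nat \<bar>x\<bar>"
  proof (rule multiplicity_le_imp_dvd)
    fix q :: nat assume q: "prime q"
    have "q ^ multiplicity q m dvd nat \<bar>x\<bar>"
      using assms(2)[OF q multiplicity_dvd] by (simp only: dvd_nat_abs_iff)
    with q False show "multiplicity q m \<le> multiplicity q (nat \<bar>x\<bar>)"
      by (intro multiplicity_geI) auto
  qed (use assms(1) in auto)
  then show ?thesis
    by (simp only: dvd_nat_abs_iff)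
qed simp

lemma multiplicity_int_int:
  assumes "prime p" "n \<ge> 1"
  shows "multiplicity (int p) (int n) = multiplicity p n"
proof (rule multiplicity_eqI)
  show "int p ^ multiplicity p n dvd int n"
    by (metis int_dvd_int_iff multiplicity_dvd of_nat_power)
  have "\<not> p ^ Suc (multiplicity p n) dvd n"
    using assms multiplicity_geI[of n p "Suc (multiplicity p n)"] not_prime_unit by fastforce
  then show "\<not> int p ^ Suc (multiplicity p n) dvd int n"
    by (metis int_dvd_int_iff of_nat_power)
qed

text \<open>Turns the type 1 condition into plain divisibility. This includes x = 0, whose valuation
  is infinite and which every power divides.\<close>

lemma val_int_less_iff:
  assumes "prime p" "n \<ge> 1"
  shows "val p (int n) < val p x \<longleftrightarrow> int (p ^ Suc (multiplicity p n)) dvd x"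
proof -
  have "\<not> is_unit (int p)"
    using assms(1) not_prime_unit by force
  moreover have "multiplicity (int p) (int n) = multiplicity p n"
    using assms by (rule multiplicity_int_int)
  ultimately show ?thesis
    using assms(2) power_dvd_iff_le_multiplicity[of x "int p" "Suc (multiplicity p n)"]
    by (auto simp: val_def Suc_le_eq)
qed

lemma val_int_eq_0_iff:
  assumes "prime p" "n \<ge> 1"
  shows "val p (int n) = 0 \<longleftrightarrow> \<not> p dvd n"
  using assms by (simp add: val_def zero_enat_def multiplicity_int_int
      prime_elem_multiplicity_eq_zero_iff)

section \<open>Edges stay inside the index divisibility set\<close>

lemma admissible_mult_mem:
  assumes n: "n \<in> index_div_set d c" and adm: "admissible d c n p"
  shows "n * p \<in> index_div_set d c"
proof -
  let ?a = "\<lambda>k. (phi d c ^^ k) 0"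
  have n1: "n \<ge> 1" and nd: "int n dvd ?a n"
    using n by (auto simp: index_div_set_def)
  have p: "prime p"
    using adm by (auto simp: admissible_def index_div_primes_def)
  have "int (n * p) dvd ?a (n * p)"
    using adm unfolding admissible_def
  proof (elim disjE conjE)
    \<comment> \<open>Type 1: \<open>?a n\<close> has a factor p to spare, so n * p divides
      \<open>?a n\<close> already, and this divides \<open>?a (n * p)\<close>.\<close>
    assume "val p (int n) < val p (?a n)"
    then have pd: "int (p ^ Suc (multiplicity p n)) dvd ?a n"
      using val_int_less_iff[OF p n1] by simp
    have "int (n * p) dvd ?a n"
    proof (rule int_dvd_if_prime_powers_dvd)
      fix q k assume q: "prime q" and k: "q ^ k dvd n * p"
      show "int (q ^ k) dvd ?a n"
      proof (cases "q = p")
        case True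
        have "k \<le> multiplicity p (n * p)"
          using k p n1 by (intro multiplicity_geI) (auto simp: True)
        also have "\<dots> = Suc (multiplicity p n)"
          using p n1 by (simp add: prime_elem_multiplicity_mult_distrib)
        finally have "int (q ^ k) dvd int (p ^ Suc (multiplicity p n))"
          unfolding True int_dvd_int_iff by (rule le_imp_power_dvd)
        then show ?thesis
          using pd by (rule dvd_trans)
      next
        case False
        then have "coprime (q ^ k) p"
          using p q by (simp add: primes_coprime)
        then have "q ^ k dvd n"
          using k by (simp add: coprime_dvd_mult_left_iff)
        then show ?thesis
          using nd by (metis dvd_trans int_dvd_int_iff)
      qed
    qed (use n1 p prime_gt_0_nat[of p] in auto)
    then show ?thesis
      using phi_iterate_dvd_mult by (rule dvd_trans)
  next
    \<comment> \<open>Type 2: n and p are coprime and both divide \<open>?a (n * p)\<close>.\<close>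
    assume "p \<in> index_div_primes d c" and "val p (int n) = 0"
    then have pd: "int p dvd ?a p" and "\<not> p dvd n"
      using val_int_eq_0_iff[OF p n1] by (auto simp: index_div_primes_def index_div_set_def)
    then have "coprime (int n) (int p)"
      using p prime_imp_coprime[of p n] by (simp add: coprime_commute[of n p])
    moreover have "int n dvd ?a (n * p)"
      using nd phi_iterate_dvd_mult by (rule dvd_trans)
    moreover have "int p dvd ?a (n * p)"
      by (rule dvd_trans[OF pd phi_iterate_dvd]) simp
    ultimately show ?thesis
      by (simp add: divides_mult)
  qed
  then show ?thesis
    using n1 p prime_gt_0_nat[of p] by (auto simp: index_div_set_def Suc_le_eq)
qed

section \<open>Descent along the largest prime factor\<close>

lemma index_div_set_predecessor:
  assumes d: "d \<ge> 2" and n: "n \<in> index_div_set d c" "n > 1"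
  obtains m p where "n = m * p" "prime p" "m \<in> index_div_set d c" "admissible d c m p"
proof -
  let ?a = "\<lambda>k. (phi d c ^^ k) 0"
  have nd: "int n dvd ?a n"
    using n by (auto simp: index_div_set_def)
  define p where "p = Max (prime_factors n)"
  have ne: "prime_factors n \<noteq> {}"
    using n(2) prime_factor_nat[of n] by (auto simp: prime_factors_dvd)
  have "p \<in> prime_factors n"
    unfolding p_def using ne by (intro Max_in) auto
  then have p: "prime p" "p dvd n"
    by (auto simp: prime_factors_dvd)
  have p_max: "q \<le> p" if "prime q" "q dvd n" for q
    unfolding p_def using that n(2) by (intro Max_ge) (auto simp: prime_factors_dvd)
  obtain m where m: "n = m * p"
    using p(2) by (metis dvdE mult.commute)
  have m1: "m \<ge> 1"
    using m n(2) by (cases m) auto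
  have period: "\<exists>r. 1 \<le> r \<and> r \<le> q \<and> r dvd n \<and> int q dvd ?a r" if "prime q" "q dvd n" for q
  proof -
    have "int q dvd ?a n"
      using that(2) nd by (metis dvd_trans int_dvd_int_iff)
    moreover have "q \<ge> 1" "n \<ge> 1"
      using that(1) n(2) prime_gt_0_nat[of q] by auto
    ultimately show ?thesis
      by (metis phi_iterate_period)
  qed
  have dvd_m: "r dvd m" if "r dvd n" "1 \<le> r" "r < p" for r
  proof -
    have "\<not> p dvd r"
      using that by (auto dest: dvd_imp_le)
    then have "coprime r p"
      using p(1) prime_imp_coprime[of p r] by (simp add: coprime_commute[of r p])
    then show ?thesis
      using that(1) m by (simp add: coprime_dvd_mult_left_iff)
  qed
  \<comment> \<open>Rigidity pulls q^k from \<open>?a n\<close> down to \<open>?a r\<close>; since r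
    divides m, it passes up to \<open>?a m\<close>.\<close>
  have transfer: "int (q ^ k) dvd ?a m"
    if "prime q" "q ^ k dvd n" "r dvd m" "int q dvd ?a r" for q k r
  proof -
    have "int (q ^ k) dvd ?a n"
      using that(2) nd by (metis dvd_trans int_dvd_int_iff)
    moreover have "r dvd n" "n \<ge> 1"
      using that(3) m n(2) by (simp, linarith)
    ultimately have "int (q ^ k) dvd ?a r"
      using d that(1,4) by (metis phi_iterate_rigid)
    also have "\<dots> dvd ?a m"
      using that(3) by (rule phi_iterate_dvd)
    finally show ?thesis .
  qed
  have type1: "admissible d c m p \<and> (\<forall>k. p ^ k dvd m \<longrightarrow> int (p ^ k) dvd ?a m)"
    if r: "r dvd m" "int p dvd ?a r" for r
  proof -
    \<comment> \<open>n has one factor p more than m, and \<open>transfer\<close> carries the full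
      p-part of n to \<open>?a m\<close>.\<close>
    have "p ^ Suc (multiplicity p m) dvd n"
      unfolding m using multiplicity_dvd by (metis mult_dvd_mono dvd_refl power_Suc2)
    then have "int (p ^ Suc (multiplicity p m)) dvd ?a m"
      using p(1) r by (intro transfer)
    then have "admissible d c m p"
      using p(1) m1 unfolding admissible_def by (blast intro: val_int_less_iff[THEN iffD2])
    moreover have "int (p ^ k) dvd ?a m" if "p ^ k dvd m" for k
      using transfer[OF p(1) _ r, of k] that m by simp
    ultimately show ?thesis by blast
  qed
  have p_part: "admissible d c m p \<and> (\<forall>k. p ^ k dvd m \<longrightarrow> int (p ^ k) dvd ?a m)"
  proof -
    obtain r where r: "1 \<le> r" "r \<le> p" "r dvd n" "int p dvd ?a r"
      using period[OF p] by blast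
    consider "r < p" | "r = p" "p dvd m" | "r = p" "\<not> p dvd m"
      using r(2) by linarith
    then show ?thesis
    proof cases
      case 3
      then have "p \<in> index_div_primes d c"
        using r p(1) by (auto simp: index_div_primes_def index_div_set_def)
      then have "admissible d c m p"
        using 3 p(1) m1 by (simp add: admissible_def val_int_eq_0_iff)
      moreover have "k = 0" if "p ^ k dvd m" for k
        using that 3(2) by (cases k) (auto dest: dvd_mult_left)
      ultimately show ?thesis
        by (metis one_dvd of_nat_1 power_0)
    qed (use r type1 dvd_m in auto)
  qed
  have "int m dvd ?a m"
  proof (rule int_dvd_if_prime_powers_dvd[OF m1])
    fix q k assume q: "prime q" and k: "q ^ k dvd m"
    \<comment> \<open>The case k = 0 is split off because q need not divide n then, and neither a
      period nor maximality of p would be available.\<close>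
    consider "q = p" | "k = 0" | "q \<noteq> p" "k > 0"
      by blast
    then show "int (q ^ k) dvd ?a m"
    proof cases
      case 3
      then have qn: "q dvd n"
        using k m by (metis dvd_mult2 dvd_power dvd_trans)
      then obtain r where r: "1 \<le> r" "r \<le> q" "r dvd n" "int q dvd ?a r"
        using period[OF q] by blast
      have "r < p"
        using p_max[OF q qn] r(2) 3(1) by linarith
      then show ?thesis
        using q k m r by (intro transfer[OF _ _ dvd_m]) auto
    qed (use p_part k in auto)
  qed
  then show thesis
    using that m p(1) m1 p_part by (auto simp: index_div_set_def)
qed

theorem theorem1p4:
  fixes d :: nat and c :: int
  assumes "d \<ge> 2"
  shows "pverts (index_div_graph d c) = index_div_set d c"
proof -
  have "n \<in> index_div_set d c" if "n \<in> index_div_verts d c" for n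
    using that by induction (auto simp: admissible_mult_mem, simp add: index_div_set_def)
  moreover have "n \<in> index_div_verts d c" if "n \<in> index_div_set d c" for n
    using that
  proof (induction n rule: less_induct)
    case (less n)
    show ?case
    proof (cases "n > 1")
      case True
      then obtain m p where mp: "n = m * p" "prime p" "m \<in> index_div_set d c" "admissible d c m p"
        using index_div_set_predecessor[OF assms less.prems] by blast
      have "m < n"
        using mp(1,2) True prime_gt_1_nat[of p] n_less_m_mult_n[of m p]
        by (cases "m = 0") (auto simp: mult.commute)
      then show ?thesis
        using less.IH mp index_div_verts.step by blast
    next
      case False
      then have "n = 1"
        using less.prems by (auto simp: index_div_set_def)
      then show ?thesis
        using index_div_verts.one by simp
    qed
  qed
  ultimately show ?thesis
    by (auto simp: index_div_graph_def)
qed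

end
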